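(* Computing an $\epsilon$-perfect allocation with the minimum number of cuts (namely two cuts) for two players requires $\Omega(\log\frac1\epsilon)$ queries in the Robertson–Webb (RW) model. That is, there are constants $c>0$ and $\epsilon_0\in(0,1)$ such that for every $0<\epsilon<\epsilon_0$, every deterministic RW protocol that, for every choice of value densities $v_1,v_2$, outputs an $\epsilon$-perfect allocation made with at most two cuts asks at least $c\log\frac1\epsilon$ queries on some instance.
   Context: Cake cutting model. The cake is $[0,1]$ and the players are $N=\{1,\dots,n\}$ (here $n=2$). Player $i$ has a private non-negative integrable value density $v_i$ on $[0,1]$ with $\int_0^1 v_i=1$, and values a measurable set $S$ at $V_i(S)=\int_S v_i(x)\,dx$. A piece is a finite union of disjoint intervals (shared endpoints are irrelevant, since sets of measure zero are worth zero). An allocation $A=(A_1,\dots,A_n)$ is a partition of $[0,1]$ into pieces, player $i$ receiving $A_i$. It is $\epsilon$-perfect if $|V_i(A_j)-1/n|\le\epsilon$ for all $i,j\in N$. For two players, the minimum number of cuts with which a perfect allocation ($V_i(A_j)=1/2$ for all $i,j$) is guaranteed to exist on every instance is two: with cuts $k\le\ell$ in $[0,1]$, one player gets $[k,\ell]$ and the other gets $[0,k]\cup[\ell,1]$. RW model. A protocol, not knowing the densities, adaptively asks the players queries of two types: $\mathrm{Cut}_i(\alpha)$, for any $\alpha\in[0,1]$: player $i$ returns a point $y$ with $V_i([0,y])=\alpha$ (ties resolved deterministically, e.g. the leftmost such point), and $y$ becomes a cut point; $\mathrm{Eval}_i(y)$, for a previously made cut point $y$: player $i$ returns $V_i([0,y])$.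 At the end the protocol outputs an allocation demarcated by cut points discovered through its queries. Protocols are deterministic and the number of queries is counted in the worst case over instances. *)

theory Defs
  imports "HOL-Analysis.Analysis"
begin

type_synonym density = "real \<Rightarrow> real"

definition piece_value :: "density \<Rightarrow> real set \<Rightarrow> real" where
  "piece_value v S = (LINT x:S|lebesgue. v x)"

definition value_density :: "density \<Rightarrow> bool" where
  "value_density v \<longleftrightarrow>
     (\<forall>x\<in>{0..1}. 0 \<le> v x) \<and> set_integrable lebesgue {0..1} v \<and> piece_value v {0..1} = 1"

(* The players are 1, ..., n; a family indexed by players is a function on nat of which only
   the values on {1..n} matter. *)

definition cake_instance :: "nat \<Rightarrow> (nat \<Rightarrow> density) \<Rightarrow> bool" where
  "cake_instance n v \<longleftrightarrow> (\<forall>i\<in>{1..n}. value_density (v i))"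

definition piece :: "real set \<Rightarrow> bool" where
  "piece S \<longleftrightarrow>
     (\<exists>\<I>. finite \<I> \<and> disjoint \<I> \<and> (\<forall>I\<in>\<I>. is_interval I \<and> I \<subseteq> {0..1}) \<and> S = \<Union>\<I>)"

(* Pieces of different players may share endpoints of intervals, hence they are only required
   to be disjoint up to a null set. *)

definition allocation :: "nat \<Rightarrow> (nat \<Rightarrow> real set) \<Rightarrow> bool" where
  "allocation n A \<longleftrightarrow>
     (\<forall>i\<in>{1..n}. piece (A i)) \<and>
     (\<Union>i\<in>{1..n}. A i) = {0..1} \<and>
     (\<forall>i\<in>{1..n}. \<forall>j\<in>{1..n}. i \<noteq> j \<longrightarrow> negligible (A i \<inter> A j))"

(* The cuts an allocation is made with: the points strictly inside the cake at which some piece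
   begins or ends. The ends 0 and 1 of the cake do not have to be cut. *)

definition cuts :: "nat \<Rightarrow> (nat \<Rightarrow> real set) \<Rightarrow> real set" where
  "cuts n A = (\<Union>i\<in>{1..n}. frontier (A i)) \<inter> {0<..<1}"

definition eps_perfect :: "nat \<Rightarrow> (nat \<Rightarrow> density) \<Rightarrow> real \<Rightarrow> (nat \<Rightarrow> real set) \<Rightarrow> bool" where
  "eps_perfect n v \<epsilon> A \<longleftrightarrow>
     (\<forall>i\<in>{1..n}. \<forall>j\<in>{1..n}. \<bar>piece_value (v i) (A j) - 1 / real n\<bar> \<le> \<epsilon>)"

datatype query = Cut nat real | Eval nat real

type_synonym history = "(query \<times> real) list"

datatype action = Ask query | Output "nat \<Rightarrow> real set"

(* A deterministic protocol chooses its next action from the queries and answers so far,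
   listed in chronological order. *)

type_synonym protocol = "history \<Rightarrow> action"

(* A deterministic way of answering Cut queries: T i v a is the point returned by player i with
   density v. It is unique except for ties; the leftmost such point is one admissible choice. *)

type_synonym cut_rule = "nat \<Rightarrow> density \<Rightarrow> real \<Rightarrow> real"

definition valid_cut_rule :: "nat \<Rightarrow> cut_rule \<Rightarrow> bool" where
  "valid_cut_rule n T \<longleftrightarrow>
     (\<forall>i\<in>{1..n}. \<forall>v. \<forall>\<alpha>\<in>{0..1}. value_density v \<longrightarrow>
        T i v \<alpha> \<in> {0..1} \<and> piece_value v {0..T i v \<alpha>} = \<alpha>)"

fun answer :: "cut_rule \<Rightarrow> (nat \<Rightarrow> density) \<Rightarrow> query \<Rightarrow> real" where
  "answer T v (Cut i \<alpha>) = T i (v i) \<alpha>"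
| "answer T v (Eval i y) = piece_value (v i) {0..y}"

definition cut_points :: "history \<Rightarrow> real set" where
  "cut_points h = {y. \<exists>i \<alpha>. (Cut i \<alpha>, y) \<in> set h}"

fun legal_query :: "nat \<Rightarrow> history \<Rightarrow> query \<Rightarrow> bool" where
  "legal_query n h (Cut i \<alpha>) \<longleftrightarrow> i \<in> {1..n} \<and> \<alpha> \<in> {0..1}"
| "legal_query n h (Eval i y) \<longleftrightarrow> i \<in> {1..n} \<and> y \<in> cut_points h"

inductive reaches :: "cut_rule \<Rightarrow> (nat \<Rightarrow> density) \<Rightarrow> protocol \<Rightarrow> history \<Rightarrow> bool"
  for T :: cut_rule and v :: "nat \<Rightarrow> density" and P :: protocol where
  start: "reaches T v P []"
| ask: "reaches T v P h \<Longrightarrow> P h = Ask q \<Longrightarrow> reaches T v P (h @ [(q, answer T v q)])"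

(* On the instance v, the protocol stops after exactly length h queries and outputs A. *)

definition halts_with ::
  "cut_rule \<Rightarrow> (nat \<Rightarrow> density) \<Rightarrow> protocol \<Rightarrow> history \<Rightarrow> (nat \<Rightarrow> real set) \<Rightarrow> bool" where
  "halts_with T v P h A \<longleftrightarrow> reaches T v P h \<and> P h = Output A"

definition rw_protocol :: "nat \<Rightarrow> cut_rule \<Rightarrow> protocol \<Rightarrow> bool" where
  "rw_protocol n T P \<longleftrightarrow>
     (\<forall>v h. cake_instance n v \<longrightarrow> reaches T v P h \<longrightarrow>
        (case P h of
           Ask q \<Rightarrow> legal_query n h q
         | Output A \<Rightarrow> allocation n A \<and> cuts n A \<subseteq> cut_points h))"

end

theory Submission
  imports Defs
begin

text \<open>
  Adversary argument. Player 1 is uniform, so a near-perfect piece is an interval from \<open>k\<close> to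
  \<open>l \<approx> k + 1/2\<close> (or the complement of one). Player 2 has density \<open>1/2\<close> on the left half of the cake;
  writing \<open>F\<close> for her cumulative value, her value of this interval is then \<open>1/2\<close> up to an error of
  about \<open>H(l) = F(l) - l/2 - 1/4\<close>. The adversary maintains a window of length \<open>2\<delta>\<close> across which \<open>H\<close>
  increases from \<open>-\<delta>\<close> to \<open>\<delta>\<close>; left of the window \<open>H \<le> -\<delta>\<close>, and right of it \<open>H \<ge> \<delta>\<close>. Every window
  contains two windows of one eighth its length, disjoint both in position and in the range of \<open>F\<close>,
  so whatever point or value the next query asks for, it misses one of them. The adversary
  continues inside that one. After \<open>n\<close> queries no cut point has entered the window and
  \<open>\<delta> = 1/8^(n+1)\<close>, so the protocol cannot stop while this is larger than \<open>3/2 \<epsilon>\<close>.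
\<close>

section \<open>Cumulative values and densities bounded away from zero\<close>

definition cumul :: "density \<Rightarrow> real \<Rightarrow> real" where
  "cumul v x = piece_value v {0..x}"

text \<open>The bound 1/2 makes cumulative values strictly increasing. Every Cut answer is then
  unique, so the adversary beats every admissible tie-breaking rule.\<close>

definition full_support :: "density \<Rightarrow> bool" where
  "full_support v \<longleftrightarrow> value_density v \<and> (\<forall>x\<in>{0..1}. 1/2 \<le> v x)"

lemma value_density_integrable:
  assumes "value_density v" "S \<in> sets lebesgue" "S \<subseteq> {0..1}"
  shows "set_integrable lebesgue S v"
  using assms set_integrable_subset unfolding value_density_def by blast

lemma piece_value_open_interval:
  assumes "value_density v" "0 \<le> x" "x \<le> y" "y \<le> 1"
  shows "piece_value v {x<..<y} = cumul v y - cumul v x"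
proof (cases "x = y")
  case False
  with assms have "x < y" by simp
  have "piece_value v {0..y} = piece_value v ({0..x} \<union> {x<..y})"
    using assms by (intro arg_cong[where f = "piece_value v"]) auto
  also have "\<dots> = piece_value v {0..x} + piece_value v {x<..y}"
    unfolding piece_value_def
    by (rule set_integral_Un) (use assms in \<open>auto intro!: value_density_integrable\<close>)
  also have "piece_value v {x<..y} = piece_value v ({x<..<y} \<union> {y})"
    using \<open>x < y\<close> by (intro arg_cong[where f = "piece_value v"]) auto
  also have "\<dots> = piece_value v {x<..<y} + piece_value v {y}"
    unfolding piece_value_def
    by (rule set_integral_Un) (use assms in \<open>auto intro!: value_density_integrable\<close>)
  also have "piece_value v {y} = 0"
    unfolding piece_value_def set_lebesgue_integral_def
    by (rule integral_eq_zero_AE, rule AE_I'[of "{y}"]) (auto simp: indicator_def)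
  finally show ?thesis unfolding cumul_def by simp
qed (simp add: piece_value_def set_lebesgue_integral_def)

lemma cumul_0: "cumul v 0 = 0"
  unfolding cumul_def piece_value_def set_lebesgue_integral_def
  by (rule integral_eq_zero_AE, rule AE_I'[of "{0}"]) (auto simp: indicator_def)

lemma cumul_1: "value_density v \<Longrightarrow> cumul v 1 = 1"
  by (simp add: cumul_def value_density_def)

lemma cumul_strict_mono:
  assumes "full_support v" "0 \<le> x" "x < y" "y \<le> 1"
  shows "cumul v x < cumul v y"
proof -
  have vd: "value_density v" using assms by (simp add: full_support_def)
  have "(LINT t:{x<..<y}|lebesgue. 1/2) \<le> (LINT t:{x<..<y}|lebesgue. v t)"
  proof (rule set_integral_mono)
    show "set_integrable lebesgue {x<..<y} v"
      using assms by (intro value_density_integrable vd) auto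
    show "set_integrable lebesgue {x<..<y} (\<lambda>t. 1/2 :: real)"
      unfolding set_integrable_def using bounded_set_imp_lmeasurable[of "{x<..<y}"]
      by (intro integrable_scaleR_left) (simp add: lmeasurable_iff_integrable)
  qed (use assms in \<open>auto simp: full_support_def\<close>)
  moreover have "(LINT t:{x<..<y}|lebesgue. 1/2 :: real) = (y - x) / 2"
    unfolding set_lebesgue_integral_def using assms by simp
  ultimately show ?thesis
    using piece_value_open_interval[OF vd, of x y] assms by (simp add: piece_value_def)
qed

lemma cumul_inj:
  assumes "full_support v" "x \<in> {0..1}" "y \<in> {0..1}" "cumul v x = cumul v y"
  shows "x = y"
  using assms cumul_strict_mono[of v x y] cumul_strict_mono[of v y x]
  by (cases x y rule: linorder_cases) auto

text \<open>The \<open>max\<close> terms are the lengths of the parts of the two steps that lie left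
  of \<open>x\<close>. By \<open>bal\<close> the steps cancel in total, so the cake is still worth
  1. Both the initial density and each narrowing of the window arise in this way.\<close>

lemma cumul_add_steps:
  assumes v: "value_density v"
    and ord: "0 \<le> a" "a \<le> p" "p \<le> q" "q \<le> b" "b \<le> 1"
    and bal: "c * (p - a) + d * (b - q) = 0"
    and w: "w = (\<lambda>x. v x + c * indicator {a<..<p} x + d * indicator {q<..<b} x)"
    and lb: "\<And>x. x \<in> {0..1} \<Longrightarrow> 1/2 \<le> w x"
  shows "full_support w"
    and "x \<in> {0..1} \<Longrightarrow> cumul w x = cumul v x + c * max 0 (min x p - a) + d * max 0 (min x b - q)"
proof -
  have ind: "(LINT t:{0..x}|lebesgue. k * indicator {r<..<s} t) = k * max 0 (min x s - r)"
    and ind_int: "set_integrable lebesgue {0..x} (\<lambda>t. k * indicator {r<..<s} t)"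
    if "0 \<le> r" "r \<le> s" for k r s x :: real
  proof -
    have eq: "indicator {0..x} t *\<^sub>R (k * indicator {r<..<s} t) = k * indicator ({0..x} \<inter> {r<..<s}) t"
      for t :: real by (simp add: indicator_def)
    have m: "({0..x} \<inter> {r<..<s}) \<in> lmeasurable"
      by (intro bounded_set_imp_lmeasurable bounded_Int) auto
    have "measure lebesgue ({0..x} \<inter> {r<..<s}) = max 0 (min x s - r)"
    proof (cases "x < s")
      case True
      then have "{0..x} \<inter> {r<..<s} = {r<..x}" using that by auto
      with True that show ?thesis by (cases "r \<le> x") auto
    next
      case False
      then have "{0..x} \<inter> {r<..<s} = {r<..<s}" using that by auto
      with False that show ?thesis by simp
    qed
    with m show "(LINT t:{0..x}|lebesgue. k * indicator {r<..<s} t) = k * max 0 (min x s - r)"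
      unfolding set_lebesgue_integral_def eq by simp
    show "set_integrable lebesgue {0..x} (\<lambda>t. k * indicator {r<..<s} t)"
      unfolding set_integrable_def eq using m
      by (intro integrable_mult_right) (simp add: fmeasurable_def)
  qed
  have int_v: "set_integrable lebesgue {0..x} v" if "x \<le> 1" for x
    using that by (intro value_density_integrable[OF v]) auto
  have *: "cumul w x = cumul v x + c * max 0 (min x p - a) + d * max 0 (min x b - q)"
    if "x \<le> 1" for x
    unfolding cumul_def piece_value_def w
    using ord that by (simp add: set_integral_add int_v ind_int ind del: set_integral_mult_right)
  then show "x \<in> {0..1} \<Longrightarrow> cumul w x = cumul v x + c * max 0 (min x p - a) + d * max 0 (min x b - q)"
    by simp
  have "set_integrable lebesgue {0..1} w"
    unfolding w using ord by (intro set_integral_add int_v ind_int) auto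
  moreover have "piece_value w {0..1} = 1"
    using *[of 1] cumul_1[OF v] bal ord by (simp add: cumul_def)
  ultimately show "full_support w"
    using lb by (force simp: full_support_def value_density_def)
qed

lemma uniform:
  shows "value_density (\<lambda>_. 1)" and "0 \<le> x \<Longrightarrow> cumul (\<lambda>_. 1) x = x"
  unfolding value_density_def piece_value_def cumul_def set_integrable_def set_lebesgue_integral_def
  by auto

section \<open>Windows in which the adversary is still undecided\<close>

text \<open>
  The outermost window is \<open>[5/8, 7/8]\<close>: player 2's density stays \<open>3/2\<close> near \<open>1/2\<close> and near \<open>1\<close>, which
  excludes intervals starting slightly to the right of \<open>1/2\<close>.
\<close>

definition crossing :: "density \<Rightarrow> real \<Rightarrow> real \<Rightarrow> bool" where
  "crossing v a \<delta> \<longleftrightarrow>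
     full_support v \<and> 0 < \<delta> \<and> 5/8 \<le> a \<and> a + 2 * \<delta> \<le> 7/8 \<and>
     (\<forall>x\<in>{a<..<a + 2 * \<delta>}. v x = 3/2) \<and>
     (\<forall>x\<in>{0..1/2}. cumul v x = x / 2) \<and>
     (\<forall>x\<in>{1/2..5/8} \<union> {7/8..1}. cumul v x = 3/2 * x - 1/2) \<and>
     (\<forall>x\<in>{1/2..a}. cumul v x \<le> x / 2 + 1/4 - \<delta>) \<and>
     (\<forall>x\<in>{a + 2 * \<delta>..1}. cumul v x \<ge> x / 2 + 1/4 + \<delta>) \<and>
     (\<forall>x\<in>{a..a + 2 * \<delta>}. cumul v x = 3/2 * x - a + 1/4 - \<delta>)"

text \<open>Agreement is asked of cumulative values and not of densities, because Eval and Cut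
  answers depend only on the former. The ends of the window count as outside it.\<close>

definition agree_off :: "density \<Rightarrow> density \<Rightarrow> real \<Rightarrow> real \<Rightarrow> bool" where
  "agree_off w v a \<delta> \<longleftrightarrow>
     full_support w \<and> (\<forall>x\<in>{0..1}. x \<notin> {a<..<a + 2 * \<delta>} \<longrightarrow> cumul w x = cumul v x)"

lemma crossing_initial: "\<exists>v. crossing v (5/8) (1/8)"
proof -
  \<comment> \<open>Up to single points the density is 1/2 on the left half and 3/2 on the right
    half. Right of 1/2 this gives H(x) = x - 3/4, which runs from -1/8 to 1/8 across
    [5/8, 7/8].\<close>
  define v :: density where
    "v = (\<lambda>x. 1 + (-1/2) * indicator {0<..<1/2} x + (1/2) * indicator {1/2<..<1} x)"
  have fs: "full_support v" and c: "x \<in> {0..1} \<Longrightarrow>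
      cumul v x = x + (-1/2) * max 0 (min x (1/2) - 0) + 1/2 * max 0 (min x 1 - 1/2)" for x
    using cumul_add_steps[OF uniform(1), of 0 "1/2" "1/2" 1 "-1/2" "1/2" v] uniform(2)
    by (auto simp: v_def indicator_def)
  have v32: "v x = 3/2" if "5/8 < x" "x < 7/8" for x using that by (simp add: v_def)
  have "crossing v (5/8) (1/8)"
    unfolding crossing_def using fs by (auto simp: c v32 field_simps)
  then show ?thesis by blast
qed

text \<open>With density 3/2, H has slope 1, so H is \<open>(t - 1) * \<delta>\<close> at
  \<open>a + t * \<delta>\<close>. The step \<open>c\<close> before that point brings H to
  \<open>-\<delta> / 8\<close> there, which means \<open>c * t = 7/8 - t\<close>; the step
  \<open>d\<close> takes the added value back after the new window. The two choices of
  \<open>t\<close> are mirror images about the midpoint of the window, which swaps \<open>c\<close>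
  and \<open>d\<close>.\<close>

lemma crossing_shrink:
  fixes t c d :: real
  assumes cr: "crossing v a \<delta>"
    and t: "(t, c, d) = (3/8, 4/3, -4/11) \<or> (t, c, d) = (11/8, -4/11, 4/3)"
  obtains w where "crossing w (a + t * \<delta>) (\<delta> / 8)"
    "\<And>u. agree_off u w (a + t * \<delta>) (\<delta> / 8) \<Longrightarrow> agree_off u v a \<delta>"
proof -
  define p where "p = a + t * \<delta>"
  define q where "q = p + \<delta> / 4"
  define b where "b = a + 2 * \<delta>"
  define w where "w = (\<lambda>x. v x + c * indicator {a<..<p} x + d * indicator {q<..<b} x)"
  note cr' = cr[unfolded crossing_def, folded b_def]
  from t have t: "t = 3/8 \<and> c = 4/3 \<and> d = -4/11 \<or> t = 11/8 \<and> c = -4/11 \<and> d = 4/3"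
    by (simp only: prod.inject)
  have \<delta>: "0 < \<delta>" and fsv: "full_support v" and ab: "5/8 \<le> a" "b \<le> 7/8" using cr' by auto
  have ord: "0 \<le> a" "a < p" "p < q" "q < b" "b \<le> 1"
    using t \<delta> ab unfolding p_def q_def b_def by (elim disjE conjE; hypsubst; simp)+
  have bal: "c * (p - a) + d * (b - q) = 0"
    using t unfolding p_def q_def b_def by (elim disjE conjE; hypsubst; simp add: algebra_simps)
  \<comment> \<open>Inside the old window the density was 3/2, and a step lowers it by at most
    4/11.\<close>
  have lb: "1/2 \<le> w x" if "x \<in> {0..1}" for x
  proof (cases "x \<in> {a<..<b}")
    case True
    then have "v x = 3/2" using cr' by auto
    then show ?thesis using t ord by (auto simp: w_def indicator_def)
  next
    case False
    then have "w x = v x" using ord by (auto simp: w_def indicator_def)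
    then show ?thesis using fsv that by (auto simp: full_support_def)
  qed
  have "value_density v" using fsv by (simp add: full_support_def)
  from cumul_add_steps[OF this _ _ _ _ _ bal w_def lb] ord
  have fs: "full_support w" and cum: "\<And>x. x \<in> {0..1} \<Longrightarrow>
      cumul w x = cumul v x + c * max 0 (min x p - a) + d * max 0 (min x b - q)" by auto
  have out: "cumul w x = cumul v x" if "x \<in> {0..1}" "x \<notin> {a<..<b}" for x
    using cum[OF that(1)] that(2) bal ord by (cases "x \<le> a") auto
  have left: "cumul w x = 3/2 * x - a + 1/4 - \<delta> + c * (x - a)" if "x \<in> {a..p}" for x
    using cum[of x] cr' that ord ab by auto
  have mid: "cumul w x = 3/2 * x - a + 1/4 - \<delta> + c * (p - a)" if "x \<in> {p..q}" for x
    using cum[of x] cr' that ord ab by auto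
  have right: "cumul w x = 3/2 * x - a + 1/4 - \<delta> - d * (b - x)" if "x \<in> {q..b}" for x
  proof -
    have "cumul w x = cumul v x + c * (p - a) + d * (x - q)" using cum[of x] that ord by simp
    moreover have "cumul v x = 3/2 * x - a + 1/4 - \<delta>" using cr' that ord by auto
    ultimately show ?thesis using bal by (simp add: algebra_simps)
  qed
  have cw: "crossing w p (\<delta> / 8)"
    unfolding crossing_def
  proof (intro conjI ballI)
    show "full_support w" by (rule fs)
    show "0 < \<delta> / 8" "5/8 \<le> p" "p + 2 * (\<delta> / 8) \<le> 7/8" using \<delta> ab ord q_def by auto
    show "w x = 3/2" if "x \<in> {p<..<p + 2 * (\<delta> / 8)}" for x
      using cr' that ord q_def by (auto simp: w_def indicator_def)
    show "cumul w x = x / 2" if "x \<in> {0..1/2}" for x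
      using out[of x] that cr' ab by auto
    show "cumul w x = 3/2 * x - 1/2" if "x \<in> {1/2..5/8} \<union> {7/8..1}" for x
      using out[of x] that cr' ab by auto
    show "cumul w x \<le> x / 2 + 1/4 - \<delta> / 8" if x: "x \<in> {1/2..p}" for x
    proof (cases "x \<le> a")
      case True
      then have "cumul v x \<le> x / 2 + 1/4 - \<delta>" using x cr' by auto
      then show ?thesis using out[of x] True x ord \<delta> by auto
    next
      case False
      \<comment> \<open>Here H has slope \<open>1 + c\<close>, which is positive, so it is largest
        at \<open>p\<close>, where it equals \<open>-\<delta> / 8\<close>.\<close>
      then have eq: "cumul w x = 3/2 * x - a + 1/4 - \<delta> + c * (x - a)" using left[of x] x by auto
      from t show ?thesis
      proof (elim disjE conjE)
        assume tcd: "t = 3/8" "c = 4/3" "d = -4/11"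
        have "x \<le> a + 3/8 * \<delta>" using x unfolding p_def tcd by simp
        with eq show ?thesis unfolding tcd by (simp add: field_simps)
      next
        assume tcd: "t = 11/8" "c = -4/11" "d = 4/3"
        have "x \<le> a + 11/8 * \<delta>" using x unfolding p_def tcd by simp
        with eq show ?thesis unfolding tcd by (simp add: field_simps)
      qed
    qed
    show "cumul w x \<ge> x / 2 + 1/4 + \<delta> / 8" if x: "x \<in> {p + 2 * (\<delta> / 8)..1}" for x
    proof (cases "b \<le> x")
      case True
      then have "cumul v x \<ge> x / 2 + 1/4 + \<delta>" using x cr' by auto
      then show ?thesis using out[of x] True x ord \<delta> by auto
    next
      case False
      then have eq: "cumul w x = 3/2 * x - a + 1/4 - \<delta> - d * (a + 2 * \<delta> - x)"
        using right[of x] x q_def b_def by auto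
      from t show ?thesis
      proof (elim disjE conjE)
        assume tcd: "t = 3/8" "c = 4/3" "d = -4/11"
        have "a + 3/8 * \<delta> + \<delta> / 4 \<le> x" using x unfolding p_def tcd by simp
        with eq show ?thesis unfolding tcd by (simp add: field_simps)
      next
        assume tcd: "t = 11/8" "c = -4/11" "d = 4/3"
        have "a + 11/8 * \<delta> + \<delta> / 4 \<le> x" using x unfolding p_def tcd by simp
        with eq show ?thesis unfolding tcd by (simp add: field_simps)
      qed
    qed
    show "cumul w x = 3/2 * x - p + 1/4 - \<delta> / 8" if "x \<in> {p..p + 2 * (\<delta> / 8)}" for x
    proof -
      \<comment> \<open>This is the equation \<open>c * t = 7/8 - t\<close> that determined
        \<open>c\<close>.\<close>
      have "\<delta> - c * (p - a) = p - a + \<delta> / 8"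
        using t unfolding p_def by (elim disjE conjE; simp only:; simp add: field_simps)
      then show ?thesis using mid[of x] that q_def by simp
    qed
  qed
  have "agree_off u v a \<delta>" if "agree_off u w p (\<delta> / 8)" for u
    unfolding agree_off_def
  proof (intro conjI ballI impI)
    show "full_support u" using that by (simp add: agree_off_def)
    fix x :: real assume "x \<in> {0..1}" "x \<notin> {a<..<a + 2 * \<delta>}"
    moreover from this have "x \<notin> {p<..<p + 2 * (\<delta> / 8)}" using ord q_def b_def by auto
    ultimately show "cumul u x = cumul v x"
      using that out[of x] by (simp add: agree_off_def b_def)
  qed
  with cw that show ?thesis unfolding p_def by blast
qed

section \<open>Intervals of length near 1/2 and allocations with two cuts\<close>

text \<open>When \<open>k \<le> 1/2 \<le> l\<close>, the signed error of the value is H(l) + (l - k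
  - 1/2)/2. Outside the window H is at least \<open>\<delta>\<close> in absolute value, so the error
  is at least \<open>\<delta> - \<epsilon> / 2\<close>, which exceeds
  \<open>\<epsilon>\<close>.\<close>

lemma crossing_no_good_interval:
  assumes cr: "crossing v a \<delta>" and \<epsilon>: "\<epsilon> < 1/16" "3/2 * \<epsilon> < \<delta>"
    and kl: "0 \<le> k" "k \<le> l" "l \<le> 1" "l \<notin> {a<..<a + 2 * \<delta>}"
    and len: "\<bar>l - k - 1/2\<bar> \<le> \<epsilon>"
  shows "\<bar>cumul v l - cumul v k - 1/2\<bar> > \<epsilon>"
proof -
  note cr' = cr[unfolded crossing_def]
  have fs: "full_support v" using cr' by simp
  consider "l < 1/2" | "1/2 \<le> l" "k \<le> 1/2" | "1/2 < k" by linarith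
  then show ?thesis
  proof cases
    case 1
    \<comment> \<open>An interval inside the left half is worth less than 1/4.\<close>
    then have "cumul v l = l / 2" "cumul v k = k / 2" using cr' kl by auto
    then show ?thesis using 1 kl \<epsilon> by auto
  next
    case 2
    then have k: "cumul v k = k / 2" using cr' kl by auto
    show ?thesis
    proof (cases "l \<le> a")
      case True
      then have "cumul v l \<le> l / 2 + 1/4 - \<delta>" using cr' 2 by auto
      then show ?thesis using k len \<epsilon> unfolding abs_le_iff by (simp add: abs_if)
    next
      case False
      then have "cumul v l \<ge> l / 2 + 1/4 + \<delta>" using cr' 2 kl by auto
      then show ?thesis using k len \<epsilon> unfolding abs_le_iff by (simp add: abs_if)
    qed
  next
    case 3
    \<comment> \<open>The length exceeds 7/16, so \<open>k < 9/16\<close> and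
      \<open>l > 15/16\<close>. At both points the initial formula still holds, and the value
      exceeds 21/32.\<close>
    then have "cumul v k = 3/2 * k - 1/2" "cumul v l = 3/2 * l - 1/2"
      using cr' kl len \<epsilon> by (auto simp: abs_le_iff)
    then show ?thesis using 3 kl len \<epsilon> by (auto simp: abs_le_iff abs_if)
  qed
qed

text \<open>A connected set that misses the frontier lies inside \<open>A\<close> or outside it.
  Hence \<open>A\<close> is, up to a null set, a union of some of the three intervals between 0,
  \<open>k\<close>, \<open>l\<close> and 1, and \<open>p\<close>, \<open>q\<close>, \<open>r\<close>
  record which. The ends of the cake replace missing cuts.\<close>

lemma two_cut_piece_value:
  assumes A: "A \<subseteq> {0..1}" and fin: "finite (frontier A \<inter> {0<..<1})"
    and card: "card (frontier A \<inter> {0<..<1}) \<le> 2"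
  obtains k l p q r where
    "k \<in> (frontier A \<inter> {0<..<1}) \<union> {0, 1}" "l \<in> (frontier A \<inter> {0<..<1}) \<union> {0, 1}" "k \<le> l"
    "p \<in> {0, 1}" "q \<in> {0, 1}" "r \<in> {0, 1}"
    "\<And>v. value_density v \<Longrightarrow>
       piece_value v A = p * cumul v k + q * (cumul v l - cumul v k) + r * (1 - cumul v l)"
proof -
  let ?C = "frontier A \<inter> {0<..<1}"
  obtain k l where kl: "k \<in> ?C \<union> {0, 1}" "l \<in> ?C \<union> {0, 1}" "k \<le> l" "?C \<subseteq> {k, l}"
  proof -
    consider "card ?C = 0" | "card ?C = 1" | "card ?C = 2" using card by linarith
    then show ?thesis
    proof cases
      case 1
      then have "?C = {}" using fin by simp
      then show ?thesis using that[of 0 1] by simp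
    next
      case 2
      then obtain k where k: "?C = {k}" by (auto simp: card_1_singleton_iff)
      then have "k \<in> {0<..<1}" by blast
      with k show ?thesis using that[of k 1] by simp
    next
      case 3
      then obtain x y where "?C = {x, y}" by (auto simp: card_2_iff)
      then show ?thesis using that[of x y] that[of y x] by (cases "x \<le> y") auto
    qed
  qed
  have k01: "0 \<le> k" "l \<le> 1" using kl by auto
  have dich: "\<exists>p\<in>{0, 1::real}. \<forall>x\<in>{y<..<z}. indicator A x = p"
    if "{y<..<z} \<inter> frontier A = {}" for y z
    using connected_Int_frontier[of "{y<..<z}" A] that by (fastforce simp: indicator_def)
  have "{0<..<k} \<inter> frontier A = {}" "{k<..<l} \<inter> frontier A = {}" "{l<..<1} \<inter> frontier A = {}"
    using kl k01 by force+
  from this[THEN dich] obtain p q r where pqr: "p \<in> {0, 1::real}" "q \<in> {0, 1::real}" "r \<in> {0, 1::real}"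
    and p: "\<And>x. x \<in> {0<..<k} \<Longrightarrow> indicator A x = p"
    and q: "\<And>x. x \<in> {k<..<l} \<Longrightarrow> indicator A x = q"
    and r: "\<And>x. x \<in> {l<..<1} \<Longrightarrow> indicator A x = r" by metis
  have "piece_value v A = p * cumul v k + q * (cumul v l - cumul v k) + r * (1 - cumul v l)"
    if v: "value_density v" for v
  proof -
    let ?f = "\<lambda>x. p * (indicator {0<..<k} x * v x) + q * (indicator {k<..<l} x * v x)
                + r * (indicator {l<..<1} x * v x)"
    let ?N = "{0, k, l, 1}"
    have int: "integrable lebesgue (\<lambda>x. indicator {y<..<z} x * v x)" if "0 \<le> y" "z \<le> 1" for y z
    proof -
      have "{y<..<z} \<subseteq> {0..1}" using that by auto
      then show ?thesis
        using value_density_integrable[OF v, of "{y<..<z}"] by (simp add: set_integrable_def)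
    qed
    have ae: "AE x in lebesgue. indicator A x *\<^sub>R v x = ?f x"
    proof (rule AE_I'[of ?N])
      show "{x \<in> space lebesgue. indicator A x *\<^sub>R v x \<noteq> ?f x} \<subseteq> ?N"
      proof (rule subsetI, rule ccontr)
        fix x assume x: "x \<in> {x \<in> space lebesgue. indicator A x *\<^sub>R v x \<noteq> ?f x}" "x \<notin> ?N"
        then consider "x \<notin> {0..1}" | "x \<in> {0<..<k}" | "x \<in> {k<..<l}" | "x \<in> {l<..<1}" by force
        then have "indicator A x *\<^sub>R v x = ?f x"
        proof cases
          case 1
          then show ?thesis using A kl(3) k01 by (auto simp: indicator_def)
        qed (use p[of x] q[of x] r[of x] kl(3) k01 in auto)
        with x show False by simp
      qed
    qed (simp add: negligible_iff_null_sets[symmetric])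
    have ints: "integrable lebesgue (\<lambda>x. indicator {0<..<k} x * v x)"
      "integrable lebesgue (\<lambda>x. indicator {k<..<l} x * v x)"
      "integrable lebesgue (\<lambda>x. indicator {l<..<1} x * v x)"
      by (rule int; use k01 kl(3) in linarith)+
    have fint: "integrable lebesgue ?f"
      by (intro Bochner_Integration.integrable_add integrable_mult_right ints)
    have "(LINT x|lebesgue. indicator A x *\<^sub>R v x) = (LINT x|lebesgue. ?f x)"
    proof (rule integral_cong_AE[OF _ _ ae])
      show "?f \<in> borel_measurable lebesgue" using fint by simp
      \<comment> \<open>\<open>A\<close> is not assumed measurable; measurability comes from almost
        everywhere equality with an integrable function.\<close>
      show "(\<lambda>x. indicator A x *\<^sub>R v x) \<in> borel_measurable lebesgue"
        using ae by (intro borel_measurable_AE[OF borel_measurable_integrable[OF fint]]) (simp add: eq_commute)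
    qed
    also have "\<dots> = p * piece_value v {0<..<k} + q * piece_value v {k<..<l} + r * piece_value v {l<..<1}"
      using ints by (simp add: piece_value_def set_lebesgue_integral_def)
    also have "\<dots> = p * cumul v k + q * (cumul v l - cumul v k) + r * (1 - cumul v l)"
      using piece_value_open_interval[OF v] k01 kl(3) cumul_0 cumul_1[OF v] by simp
    finally show ?thesis by (simp add: piece_value_def set_lebesgue_integral_def)
  qed
  with kl pqr show ?thesis using that by blast
qed

text \<open>The piece of player 1 alone gives the contradiction. It has eight possible shapes: the
  empty and the full one fail for the uniform player, and each other one is an interval, or the
  complement of one, whose right end is \<open>k\<close>, \<open>l\<close> or 1 and so avoids the
  window.\<close>

lemma crossing_not_eps_perfect:
  assumes cr: "crossing v a \<delta>" and \<epsilon>: "\<epsilon> < 1/16" "3/2 * \<epsilon> < \<delta>"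
    and al: "allocation 2 A" and cuts: "finite (cuts 2 A)" "card (cuts 2 A) \<le> 2"
      "cuts 2 A \<inter> {a<..<a + 2 * \<delta>} = {}"
    and w: "w 1 = (\<lambda>_. 1)" "w 2 = v"
  shows "\<not> eps_perfect 2 w \<epsilon> A"
proof
  assume ep: "eps_perfect 2 w \<epsilon> A"
  have perf: "\<bar>piece_value (\<lambda>_. 1) (A 1) - 1/2\<bar> \<le> \<epsilon>" "\<bar>piece_value v (A 1) - 1/2\<bar> \<le> \<epsilon>"
    using ep[unfolded eps_perfect_def, rule_format, of 1 1] ep[unfolded eps_perfect_def, rule_format, of 2 1] w
    by simp_all
  have A: "A 1 \<subseteq> {0..1}" using al unfolding allocation_def by force
  let ?C = "frontier (A 1) \<inter> {0<..<1}"
  have sub: "?C \<subseteq> cuts 2 A" unfolding cuts_def by force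
  have "finite ?C" "card ?C \<le> 2"
    using sub cuts finite_subset card_mono[OF cuts(1) sub] by auto
  from two_cut_piece_value[OF A this] obtain k l p q r where
    kl: "k \<in> ?C \<union> {0, 1}" "l \<in> ?C \<union> {0, 1}" "k \<le> l"
    and pqr: "p \<in> {0, 1}" "q \<in> {0, 1}" "r \<in> {0, 1}"
    and pv: "\<And>v. value_density v \<Longrightarrow>
       piece_value v (A 1) = p * cumul v k + q * (cumul v l - cumul v k) + r * (1 - cumul v l)" by blast
  have ab: "5/8 \<le> a" "a + 2 * \<delta> \<le> 7/8" and vd: "value_density v"
    using cr by (auto simp: crossing_def full_support_def)
  have k: "0 \<le> k" "k \<le> 1" "k \<notin> {a<..<a + 2 * \<delta>}" and l: "0 \<le> l" "l \<le> 1" "l \<notin> {a<..<a + 2 * \<delta>}"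
    using kl sub cuts(3) ab by (auto simp del: greaterThanLessThan_iff) auto
  have no: "\<bar>cumul v y - cumul v x - 1/2\<bar> > \<epsilon>"
    if "\<bar>y - x - 1/2\<bar> \<le> \<epsilon>" "0 \<le> x" "x \<le> y" "y \<in> {l, k, 1}" for x y
    by (rule crossing_no_good_interval[OF cr \<epsilon>]) (use that k l ab in auto)
  have len: "\<bar>p * k + q * (l - k) + r * (1 - l) - 1/2\<bar> \<le> \<epsilon>"
    using perf(1) pv[OF uniform(1)] k l by (simp add: uniform(2))
  have val: "\<bar>p * cumul v k + q * (cumul v l - cumul v k) + r * (1 - cumul v l) - 1/2\<bar> \<le> \<epsilon>"
    using perf(2) pv[OF vd] by simp
  note cumul_ends = cumul_0[of v] cumul_1[OF vd]
  consider "p = 0" "q = 0" "r = 0" | "p = 1" "q = 0" "r = 0" | "p = 0" "q = 1" "r = 0"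
    | "p = 0" "q = 0" "r = 1" | "p = 1" "q = 1" "r = 0" | "p = 1" "q = 0" "r = 1"
    | "p = 0" "q = 1" "r = 1" | "p = 1" "q = 1" "r = 1" using pqr by auto
  then show False
  proof cases
    case 1
    with len \<epsilon>(1) show False by simp
  next
    case 2
    with len val no[of k 0] k cumul_ends show False by simp
  next
    case 3
    with len val no[of l k] k kl(3) show False by simp
  next
    case 4
    with len val no[of 1 l] l cumul_ends show False by simp
  next
    case 5
    with len val no[of l 0] l cumul_ends show False by simp
  next
    case 6
    \<comment> \<open>The piece is the complement of the interval from \<open>k\<close> to
      \<open>l\<close>, so both errors only change sign.\<close>
    with len have "\<bar>l - k - 1/2\<bar> \<le> \<epsilon>" by (simp; linarith)
    from no[OF this] k kl(3) have "\<bar>cumul v l - cumul v k - 1/2\<bar> > \<epsilon>" by simp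
    with val 6 show False by (simp; linarith)
  next
    case 7
    with len val no[of 1 k] k cumul_ends show False by simp
  next
    case 8
    with len \<epsilon>(1) show False by simp
  qed
qed

section \<open>Runs of a deterministic protocol\<close>

lemma reaches_take:
  assumes "reaches T v P h" "k < length h"
  shows "reaches T v P (take k h) \<and> (\<exists>q. P (take k h) = Ask q)"
  using assms by (induction rule: reaches.induct) (auto simp: less_Suc_eq)

lemma reaches_unique:
  assumes "reaches T v P h" "reaches T v P h'" "length h = length h'"
  shows "h = h'"
  using assms
proof (induction arbitrary: h' rule: reaches.induct)
  case (ask h q)
  from ask.prems(1) show ?case
  proof cases
    case start
    with ask.prems show ?thesis by simp
  next
    case (ask h2 q2)
    with ask.IH[of h2] ask.hyps ask.prems show ?thesis by auto
  qed
qed simp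

text \<open>A longer run would have \<open>h'\<close> as a proper prefix, at which the protocol asks
  instead of stopping. So any reached history bounds the number of queries from below.\<close>

lemma halts_length_ge:
  assumes "reaches T v P h" "halts_with T v P h' A"
  shows "length h \<le> length h'"
proof (rule ccontr)
  assume "\<not> length h \<le> length h'"
  then have *: "reaches T v P (take (length h') h) \<and> (\<exists>q. P (take (length h') h) = Ask q)"
    using reaches_take[OF assms(1), of "length h'"] by simp
  moreover have "take (length h') h = h'"
    using * assms(2) \<open>\<not> length h \<le> length h'\<close>
    by (intro reaches_unique[of T v P]) (auto simp: halts_with_def)
  ultimately show False using assms(2) by (simp add: halts_with_def)
qed

section \<open>The adversary and its invariant\<close>

definition two_players :: "density \<Rightarrow> nat \<Rightarrow> density" where
  "two_players v i = (if i = 1 then (\<lambda>_. 1) else v)"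

lemma cake_instance_two_players: "full_support v \<Longrightarrow> cake_instance 2 (two_players v)"
  by (auto simp: cake_instance_def two_players_def full_support_def uniform)

text \<open>The two sub-windows are separated in position by \<open>a + \<delta>\<close> and in
  value by \<open>a / 2 + 1/4 + \<delta> / 2\<close>, so the new cut point misses one of them. The
  answer \<open>y\<close> is common to all densities the adversary can still choose.\<close>

lemma adversary_step:
  assumes T: "valid_cut_rule 2 T" and cr: "crossing v a \<delta>"
    and legal: "legal_query 2 h q" and cp: "cut_points h \<subseteq> {0..1} - {a<..<a + 2 * \<delta>}"
  obtains w a' y where "crossing w a' (\<delta> / 8)"
    "\<And>u. agree_off u w a' (\<delta> / 8) \<Longrightarrow> agree_off u v a \<delta>"
    "\<And>u. agree_off u w a' (\<delta> / 8) \<Longrightarrow> answer T (two_players u) q = y"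
    "cut_points (h @ [(q, y)]) \<subseteq> {0..1} - {a'<..<a' + 2 * (\<delta> / 8)}"
proof -
  obtain wl where wl: "crossing wl (a + 3/8 * \<delta>) (\<delta> / 8)"
    "\<And>u. agree_off u wl (a + 3/8 * \<delta>) (\<delta> / 8) \<Longrightarrow> agree_off u v a \<delta>"
    using crossing_shrink[OF cr, of "3/8" "4/3" "-4/11"] by auto
  obtain wr where wr: "crossing wr (a + 11/8 * \<delta>) (\<delta> / 8)"
    "\<And>u. agree_off u wr (a + 11/8 * \<delta>) (\<delta> / 8) \<Longrightarrow> agree_off u v a \<delta>"
    using crossing_shrink[OF cr, of "11/8" "-4/11" "4/3"] by auto
  have \<delta>: "0 < \<delta>" using cr by (simp add: crossing_def)
  have cpl: "cut_points h \<subseteq> {0..1} - {a + 3/8 * \<delta><..<a + 3/8 * \<delta> + 2 * (\<delta> / 8)}"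
    and cpr: "cut_points h \<subseteq> {0..1} - {a + 11/8 * \<delta><..<a + 11/8 * \<delta> + 2 * (\<delta> / 8)}"
    using cp \<delta> by fastforce+
  have app_cut: "cut_points (h @ [(Cut i \<alpha>, y)]) = insert y (cut_points h)" for i \<alpha> y
    by (auto simp: cut_points_def)
  have app_eval: "cut_points (h @ [(Eval i z, y)]) = cut_points h" for i z y
    by (auto simp: cut_points_def)
  have T_cumul: "T i u \<alpha> \<in> {0..1} \<and> cumul u (T i u \<alpha>) = \<alpha>"
    if "i \<in> {1..2}" "\<alpha> \<in> {0..1}" "value_density u" for i u \<alpha>
    using T that by (simp add: valid_cut_rule_def cumul_def)
  show ?thesis
  proof (cases q)
    case (Eval i z)
    with legal have z: "z \<in> cut_points h" and i: "i = 1 \<or> i = 2" by auto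
    \<comment> \<open>Old cut points avoid the window, so the answer is already settled and either
      sub-window would do.\<close>
    have "answer T (two_players u) q = (if i = 1 then z else cumul v z)"
      if "agree_off u v a \<delta>" for u
      using that z cp i uniform(2)[of z] Eval
      by (fastforce simp: two_players_def agree_off_def cumul_def)
    with wl cpl show ?thesis by (intro that[of wl _ _]) (auto simp: Eval app_eval)
  next
    case (Cut i \<alpha>)
    with legal have \<alpha>: "\<alpha> \<in> {0..1}" and i: "i = 1 \<or> i = 2" by auto
    show ?thesis
    proof (cases "i = 1")
      case True
      have ans: "answer T (two_players u) q = \<alpha>" for u
        using T_cumul[of 1 \<alpha> "\<lambda>_. 1"] uniform(1) uniform(2)[of "T 1 (\<lambda>_. 1) \<alpha>"] \<alpha> True Cut
        by (simp add: two_players_def)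
      show ?thesis
      proof (cases "\<alpha> \<le> a + \<delta>")
        case True
        with \<delta> \<alpha> have "\<alpha> \<in> {0..1} - {a + 11/8 * \<delta><..<a + 11/8 * \<delta> + 2 * (\<delta> / 8)}" by simp
        with wr cpr ans show ?thesis by (intro that[of wr _ \<alpha>]) (auto simp: Cut app_cut)
      next
        case False
        with \<delta> \<alpha> have "\<alpha> \<in> {0..1} - {a + 3/8 * \<delta><..<a + 3/8 * \<delta> + 2 * (\<delta> / 8)}" by simp
        with wl cpl ans show ?thesis by (intro that[of wl _ \<alpha>]) (auto simp: Cut app_cut)
      qed
    next
      case False
      with i have i2: "i = 2" by simp
      \<comment> \<open>The answer for \<open>w\<close> lies where \<open>u\<close> and
        \<open>w\<close> agree, so \<open>u\<close> also has value \<open>\<alpha>\<close> there;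
        injectivity makes it the answer for \<open>u\<close>.\<close>
      have same: "answer T (two_players u) q = T 2 w \<alpha>"
        if "crossing w a' (\<delta> / 8)" "agree_off u w a' (\<delta> / 8)" "T 2 w \<alpha> \<notin> {a'<..<a' + 2 * (\<delta> / 8)}"
        for u w a'
      proof -
        have fs: "full_support w" "full_support u"
          using that by (auto simp: crossing_def agree_off_def)
        then have "value_density w" "value_density u" by (auto simp: full_support_def)
        with T_cumul[of 2 \<alpha>] \<alpha> have *: "T 2 w \<alpha> \<in> {0..1}" "cumul w (T 2 w \<alpha>) = \<alpha>"
          "T 2 u \<alpha> \<in> {0..1}" "cumul u (T 2 u \<alpha>) = \<alpha>" by auto
        with that have "cumul u (T 2 w \<alpha>) = \<alpha>" by (simp add: agree_off_def)
        with * cumul_inj[OF fs(2)] have "T 2 u \<alpha> = T 2 w \<alpha>" by metis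
        then show ?thesis by (simp add: Cut i2 two_players_def)
      qed
      have T_in: "T 2 w \<alpha> \<in> {0..1} \<and> cumul w (T 2 w \<alpha>) = \<alpha>" if "crossing w a' d" for w a' d
        using that T_cumul[of 2 \<alpha> w] \<alpha> by (simp add: crossing_def full_support_def)
      show ?thesis
      \<comment> \<open>Relative to \<open>a / 2 + 1/4\<close>, the values taken on the left
        sub-window end at \<open>7/16 * \<delta>\<close> and those on the right one start at
        \<open>9/16 * \<delta>\<close>.\<close>
      proof (cases "\<alpha> \<le> a / 2 + 1/4 + \<delta> / 2")
        case True
        let ?y = "T 2 wr \<alpha>" and ?a = "a + 11/8 * \<delta>"
        have "?y \<notin> {?a<..<?a + 2 * (\<delta> / 8)}"
        proof
          assume y: "?y \<in> {?a<..<?a + 2 * (\<delta> / 8)}"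
          have "cumul wr ?y = 3/2 * ?y - ?a + 1/4 - \<delta> / 8"
            using wr(1) y unfolding crossing_def by auto
          with T_in[OF wr(1)] y True \<delta> show False by auto
        qed
        with same[OF wr(1)] wr cpr T_in[OF wr(1)] show ?thesis
          by (intro that[of wr _ ?y]) (auto simp: Cut app_cut)
      next
        case False
        let ?y = "T 2 wl \<alpha>" and ?a = "a + 3/8 * \<delta>"
        have "?y \<notin> {?a<..<?a + 2 * (\<delta> / 8)}"
        proof
          assume y: "?y \<in> {?a<..<?a + 2 * (\<delta> / 8)}"
          have "cumul wl ?y = 3/2 * ?y - ?a + 1/4 - \<delta> / 8"
            using wl(1) y unfolding crossing_def by auto
          with T_in[OF wl(1)] y False \<delta> show False by auto
        qed
        with same[OF wl(1)] wl cpl T_in[OF wl(1)] show ?thesis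
          by (intro that[of wl _ ?y]) (auto simp: Cut app_cut)
      qed
    qed
  qed
qed

text \<open>The history is the same for every density that agrees off the window, so all of them
  remain possible. The bound \<open>12 * \<epsilon> * 8 ^ n < 1\<close> says that
  \<open>3/2 * \<epsilon>\<close> is below the half-width \<open>1 / 8 ^ Suc n\<close>; while this
  holds, stopping contradicts correctness.\<close>

lemma adversary:
  assumes T: "valid_cut_rule 2 T" and P: "rw_protocol 2 T P"
    and correct: "\<And>v. cake_instance 2 v \<Longrightarrow>
      \<exists>h A. halts_with T v P h A \<and> eps_perfect 2 v \<epsilon> A \<and> card (cuts 2 A) \<le> 2"
    and \<epsilon>: "0 < \<epsilon>" "\<epsilon> < 1/16" "12 * \<epsilon> * 8 ^ n < 1"
  shows "\<exists>v a h. crossing v a (1 / 8 ^ Suc n) \<and> length h = n \<and>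
    cut_points h \<subseteq> {0..1} - {a<..<a + 2 * (1 / 8 ^ Suc n)} \<and>
    (\<forall>u. agree_off u v a (1 / 8 ^ Suc n) \<longrightarrow> reaches T (two_players u) P h)"
  using \<epsilon>(3)
proof (induction n)
  case 0
  from crossing_initial show ?case
    by (force simp: cut_points_def intro: reaches.start)
next
  case (Suc n)
  let ?\<delta> = "1 / 8 ^ Suc n :: real"
  have "12 * \<epsilon> * 8 ^ n \<le> 12 * \<epsilon> * 8 ^ Suc n" using \<epsilon>(1) by simp
  with Suc.prems have small: "12 * \<epsilon> * 8 ^ n < 1" by linarith
  from Suc.IH[OF this] obtain v a h where cr: "crossing v a ?\<delta>" and len: "length h = n"
    and cp: "cut_points h \<subseteq> {0..1} - {a<..<a + 2 * ?\<delta>}"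
    and re: "\<And>u. agree_off u v a ?\<delta> \<Longrightarrow> reaches T (two_players u) P h" by blast
  have fs: "full_support v" using cr by (simp add: crossing_def)
  then have inst: "cake_instance 2 (two_players v)" by (rule cake_instance_two_players)
  have rv: "reaches T (two_players v) P h" using re[of v] fs by (simp add: agree_off_def)
  have ok: "case P h of Ask q \<Rightarrow> legal_query 2 h q | Output A \<Rightarrow> allocation 2 A \<and> cuts 2 A \<subseteq> cut_points h"
    using P inst rv by (auto simp: rw_protocol_def)
  show ?case
  proof (cases "P h")
    case (Output A)
    then have hh: "halts_with T (two_players v) P h A" using rv by (simp add: halts_with_def)
    from correct[OF inst] obtain h' A' where h': "halts_with T (two_players v) P h' A'"
      "eps_perfect 2 (two_players v) \<epsilon> A'" "card (cuts 2 A') \<le> 2" by blast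
    \<comment> \<open>\<open>correct\<close> only yields some halting run; determinism identifies it
      with the current one.\<close>
    have "length h = length h'"
      using halts_length_ge[of T "two_players v" P] hh h'(1) by (meson halts_with_def le_antisym)
    then have "h = h'" using reaches_unique rv h'(1) by (auto simp: halts_with_def)
    then have "A' = A" using Output h'(1) by (simp add: halts_with_def)
    have al: "allocation 2 A" "cuts 2 A \<subseteq> cut_points h" using ok Output by auto
    have "finite (cut_points h)"
      by (rule finite_subset[of _ "snd ` set h"]) (force simp: cut_points_def, simp)
    then have "finite (cuts 2 A)" using al finite_subset by blast
    moreover have "3/2 * \<epsilon> < ?\<delta>" using small by (simp add: field_simps)
    ultimately have "\<not> eps_perfect 2 (two_players v) \<epsilon> A"
      using al cp h'(3) \<open>A' = A\<close> \<epsilon>(2)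
      by (intro crossing_not_eps_perfect[OF cr]) (auto simp: two_players_def)
    with h'(2) \<open>A' = A\<close> show ?thesis by simp
  next
    case (Ask q)
    with ok have "legal_query 2 h q" by simp
    from adversary_step[OF T cr this cp] obtain w a' y where w: "crossing w a' (?\<delta> / 8)"
      and ag: "\<And>u. agree_off u w a' (?\<delta> / 8) \<Longrightarrow> agree_off u v a ?\<delta>"
      and ans: "\<And>u. agree_off u w a' (?\<delta> / 8) \<Longrightarrow> answer T (two_players u) q = y"
      and cp': "cut_points (h @ [(q, y)]) \<subseteq> {0..1} - {a'<..<a' + 2 * (?\<delta> / 8)}" by blast
    have "reaches T (two_players u) P (h @ [(q, y)])" if "agree_off u w a' (?\<delta> / 8)" for u
      using reaches.ask[OF re[OF ag[OF that]] Ask] ans[OF that] by simp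
    moreover have "?\<delta> / 8 = 1 / 8 ^ Suc (Suc n)" by simp
    ultimately show ?thesis using w cp' len
      by (intro exI[of _ w] exI[of _ a'] exI[of _ "h @ [(q, y)]"]) (metis length_append_singleton)
  qed
qed

section \<open>Choice of constants for the logarithmic bound\<close>

theorem theorem5p2:
  "\<exists>c>0. \<exists>\<epsilon>\<^sub>0. 0 < \<epsilon>\<^sub>0 \<and> \<epsilon>\<^sub>0 < 1 \<and>
     (\<forall>(\<epsilon>::real) T P.
        0 < \<epsilon> \<and> \<epsilon> < \<epsilon>\<^sub>0 \<and> valid_cut_rule 2 T \<and> rw_protocol 2 T P \<and>
        (\<forall>v. cake_instance 2 v \<longrightarrow>
           (\<exists>h A. halts_with T v P h A \<and> eps_perfect 2 v \<epsilon> A \<and> card (cuts 2 A) \<le> 2))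
        \<longrightarrow> (\<exists>v h A. cake_instance 2 v \<and> halts_with T v P h A \<and>
               c * ln (1 / \<epsilon>) \<le> real (length h)))"
proof -
  \<comment> \<open>The factor 2 keeps \<open>8 ^ n\<close> below
    \<open>8 / sqrt \<epsilon>\<close>, where the 8 pays for rounding \<open>n\<close> up. Then
    \<open>12 * \<epsilon> * 8 ^ n\<close> is at most \<open>96 * sqrt \<epsilon>\<close>, and
    \<open>\<epsilon> < 1/10000\<close> makes this less than 1.\<close>
  define c :: real where "c = 1 / (2 * ln 8)"
  have c: "c > 0" by (simp add: c_def)
  have "\<exists>v h A. cake_instance 2 v \<and> halts_with T v P h A \<and> c * ln (1 / \<epsilon>) \<le> real (length h)"
    if \<epsilon>: "0 < \<epsilon>" "\<epsilon> < 1/10000" and T: "valid_cut_rule 2 T" and P: "rw_protocol 2 T P"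
      and correct: "\<And>v. cake_instance 2 v \<Longrightarrow>
        \<exists>h A. halts_with T v P h A \<and> eps_perfect 2 v \<epsilon> A \<and> card (cuts 2 A) \<le> 2"
    for \<epsilon> T P
  proof -
    define n where "n = nat \<lceil>c * ln (1 / \<epsilon>)\<rceil>"
    have ln: "ln (1 / \<epsilon>) > 0" using \<epsilon> by simp
    have n: "c * ln (1 / \<epsilon>) \<le> real n" "real n \<le> c * ln (1 / \<epsilon>) + 1"
      using ln c unfolding n_def by auto
    have "real n * ln 8 \<le> (c * ln (1 / \<epsilon>) + 1) * ln 8" using n by (intro mult_right_mono) auto
    also have "\<dots> = ln (1 / \<epsilon>) / 2 + ln 8" by (simp add: c_def field_simps)
    also have "\<dots> = ln (8 / sqrt \<epsilon>)" using \<epsilon> by (simp add: ln_div ln_sqrt)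
    finally have "ln (8 ^ n) \<le> ln (8 / sqrt \<epsilon>)" by (simp add: ln_realpow)
    then have 8: "8 ^ n \<le> 8 / sqrt \<epsilon>" using \<epsilon> by simp
    have "sqrt \<epsilon> < sqrt ((1/100)\<^sup>2)" using \<epsilon> by (intro real_sqrt_less_mono) (simp add: power2_eq_square)
    then have s: "sqrt \<epsilon> < 1/100" by simp
    have "12 * \<epsilon> * 8 ^ n \<le> 12 * \<epsilon> * (8 / sqrt \<epsilon>)" using 8 \<epsilon> by (intro mult_left_mono) auto
    also have "\<dots> = 96 * sqrt \<epsilon>" using \<epsilon> by (simp add: real_div_sqrt field_simps)
    finally have small: "12 * \<epsilon> * 8 ^ n < 1" using s by simp
    from adversary[OF T P correct _ _ small] \<epsilon> obtain v a h where
      cr: "crossing v a (1 / 8 ^ Suc n)" and len: "length h = n"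
      and re: "\<And>u. agree_off u v a (1 / 8 ^ Suc n) \<Longrightarrow> reaches T (two_players u) P h" by auto
    have fs: "full_support v" using cr by (simp add: crossing_def)
    then have inst: "cake_instance 2 (two_players v)" by (rule cake_instance_two_players)
    from correct[OF inst] obtain h' A where h': "halts_with T (two_players v) P h' A" by blast
    have "n \<le> length h'"
      using halts_length_ge[OF re[of v] h'] fs len by (simp add: agree_off_def)
    with n h' inst show ?thesis by (meson of_nat_le_iff order_trans)
  qed
  then show ?thesis using c
    by (intro exI[of _ c] conjI exI[of _ "1/10000"]) auto
qed

end
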